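(* Let $H=(V,\mathcal F)$ be a hypergraph with $n$ winning sets such that each winning set contains exactly $k$ vertices, each vertex belongs to exactly $\ell$ winning sets, and each pair of distinct vertices belongs to at most $q$ winning sets. Let $s\in\{1,\dots,k\}$. Let $I=\{k-2\lfloor k/2\rfloor,\dots,k-4,k-2,k\}$ (the integers $i$ with $0\le i\le k$ and $i\equiv k \pmod 2$). For each $i\in I$ let $X_i$ be a random variable with binomial distribution $\mathcal B(i,1/2)$ and let $p_{s,i}=\mathbb P\left(\frac{k-i}{2}+X_i\ge s\right)$. Let $z$ be the optimal value of the linear program $$\text{maximize } \sum_{i\in I} p_{s,i}\, m_i \quad\text{subject to}\quad \sum_{i\in I} m_i=1,\qquad \sum_{i\in I} i\, m_i\ \ge\ \frac{k(\ell-q)}{\ell},\qquad m_i\ge 0\ (i\in I).$$ Then $\mathrm{SC}_2(H,s)\le z\cdot n$.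
   Context: An $s$-of-$k$ game on a $k$-uniform hypergraph $(V,\mathcal F)$ (finite vertex set $V$, $\mathcal F$ a family of $k$-element subsets of $V$ called winning sets) with integer $1\le s\le k$: Maker and Breaker alternately claim previously unclaimed vertices, Maker first, until all vertices are claimed. The score is the number of winning sets in which Maker has claimed at least $s$ vertices; Maker wants to maximize it, Breaker to minimize it. A pairing strategy for Maker: before the game Maker fixes a collection of pairwise disjoint 2-element subsets (pairs) of $V$; whenever Breaker claims a vertex of a pair whose other vertex is still unclaimed, Maker responds by claiming that other vertex (her other moves are arbitrary). $\mathrm{SC}_2(H,s)$ denotes the largest score Maker can guarantee against every Breaker strategy when she is restricted to pairing strategies.
   Formalization: The number of vertices |V| is assumed to be even: for odd |V| the claim fails, e.g. for a single vertex forming the only winning set (k=ℓ=n=s=1), where Maker scores 1 but z·n=1/2. Maker's guarantee must hold for every choice of her arbitrary moves. *)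

theory Defs
  imports "HOL-Probability.Probability"
begin

text \<open>
  A position is the list \<open>h\<close> of the vertices claimed so far, in order. Maker moves first, so the
  vertices at even indices are hers, and it is her turn iff \<open>length h\<close> is even. A strategy of
  either player maps positions to the next vertex; its values at positions in which the opponent
  is to move are never used.
\<close>

type_synonym 'a strategy = "'a list \<Rightarrow> 'a"

definition legal_strategy :: "'a set \<Rightarrow> 'a strategy \<Rightarrow> bool" where
  "legal_strategy V \<sigma> \<longleftrightarrow> (\<forall>h. distinct h \<and> set h \<subset> V \<longrightarrow> \<sigma> h \<in> V - set h)"

fun play :: "'a strategy \<Rightarrow> 'a strategy \<Rightarrow> nat \<Rightarrow> 'a list" where
  "play \<sigma> \<tau> 0 = []"
| "play \<sigma> \<tau> (Suc n) =
     play \<sigma> \<tau> n @ [if even n then \<sigma> (play \<sigma> \<tau> n) else \<tau> (play \<sigma> \<tau> n)]"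

definition maker_claimed :: "'a list \<Rightarrow> 'a set" where
  "maker_claimed h = {h ! i | i. i < length h \<and> even i}"

definition score :: "'a set set \<Rightarrow> nat \<Rightarrow> 'a list \<Rightarrow> nat" where
  "score F s h = card {e \<in> F. s \<le> card (e \<inter> maker_claimed h)}"

definition pairing :: "'a set \<Rightarrow> 'a set set \<Rightarrow> bool" where
  "pairing V P \<longleftrightarrow> (\<forall>p\<in>P. p \<subseteq> V \<and> card p = 2) \<and> pairwise disjnt P"

text \<open>
  In the next definition \<open>v\<close> is the vertex Breaker has just claimed (at the odd index \<open>length h\<close>).
\<close>

definition follows_pairing :: "'a set \<Rightarrow> 'a set set \<Rightarrow> 'a strategy \<Rightarrow> bool" where
  "follows_pairing V P \<sigma> \<longleftrightarrow>
     (\<forall>h v w. distinct (h @ [v]) \<and> set (h @ [v]) \<subseteq> V \<and> odd (length h) \<and>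
        {v, w} \<in> P \<and> w \<notin> set (h @ [v]) \<longrightarrow> \<sigma> (h @ [v]) = w)"

text \<open>
  A pairing strategy is determined by its pairs, and leaves the moves that are not responses
  inside a pair unspecified. The score it guarantees therefore has to be reached whatever these
  moves are: \<open>\<sigma>\<close> is universally quantified. (Were Maker allowed to optimize these moves,
  every strategy would be a pairing strategy, for the empty collection of pairs.)
\<close>

definition pairing_guarantees :: "'a set \<Rightarrow> 'a set set \<Rightarrow> nat \<Rightarrow> 'a set set \<Rightarrow> nat \<Rightarrow> bool" where
  "pairing_guarantees V F s P t \<longleftrightarrow>
     (\<forall>\<sigma> \<tau>. legal_strategy V \<sigma> \<and> follows_pairing V P \<sigma> \<and> legal_strategy V \<tau> \<longrightarrow>
        t \<le> score F s (play \<sigma> \<tau> (card V)))"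

definition SC2 :: "'a set \<Rightarrow> 'a set set \<Rightarrow> nat \<Rightarrow> nat" where
  "SC2 V F s = Max {t. \<exists>P. pairing V P \<and> pairing_guarantees V F s P t}"

definition lp_indices :: "nat \<Rightarrow> nat set" where
  "lp_indices k = {i. i \<le> k \<and> i mod 2 = k mod 2}"

definition lp_coeff :: "nat \<Rightarrow> nat \<Rightarrow> nat \<Rightarrow> real" where
  "lp_coeff k s i =
     measure_pmf.prob (binomial_pmf i (1/2)) {x. (real k - real i) / 2 + real x \<ge> real s}"

definition lp_feasible :: "nat \<Rightarrow> nat \<Rightarrow> nat \<Rightarrow> (nat \<Rightarrow> real) \<Rightarrow> bool" where
  "lp_feasible k l q m \<longleftrightarrow>
     (\<Sum>i\<in>lp_indices k. m i) = 1 \<and>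
     (\<Sum>i\<in>lp_indices k. real i * m i) \<ge> real k * (real l - real q) / real l \<and>
     (\<forall>i\<in>lp_indices k. m i \<ge> 0)"

definition lp_optimum :: "nat \<Rightarrow> nat \<Rightarrow> nat \<Rightarrow> nat \<Rightarrow> real" where
  "lp_optimum k l q s =
     Sup {(\<Sum>i\<in>lp_indices k. lp_coeff k s i * m i) | m. lp_feasible k l q m}"

text \<open>The maximum and the supremum above are not taken over degenerate sets.\<close>

lemma ex_strategy_following_pairing:
  assumes "pairing V P"
  shows "\<exists>\<sigma>. legal_strategy V \<sigma> \<and> follows_pairing V P \<sigma>"
proof -
  define R where "R h w \<longleftrightarrow> h \<noteq> [] \<and> {last h, w} \<in> P \<and> w \<notin> set h" for h w
  define \<sigma> where "\<sigma> h = (if \<exists>w. R h w then SOME w. R h w else SOME v. v \<in> V - set h)" for h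
  have uniq: "w = w'" if "R h w" "R h w'" for h w w'
  proof -
    have P: "{last h, w} \<in> P" "{last h, w'} \<in> P"
      using that by (auto simp: R_def)
    have "{last h, w} = {last h, w'}"
    proof (rule ccontr)
      assume "{last h, w} \<noteq> {last h, w'}"
      have "pairwise disjnt P"
        using assms by (simp add: pairing_def)
      then have "disjnt {last h, w} {last h, w'}"
        using P \<open>{last h, w} \<noteq> {last h, w'}\<close> by (rule pairwiseD)
      then show False by (simp add: disjnt_def)
    qed
    then show ?thesis by (auto simp: doubleton_eq_iff)
  qed
  have \<sigma>_eq: "\<sigma> h = w" if "R h w" for h w
  proof -
    have "R h (SOME w. R h w)" using that by (rule someI)
    then have "(SOME w. R h w) = w" using that uniq by blast
    then show ?thesis using that by (auto simp: \<sigma>_def)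
  qed
  have "legal_strategy V \<sigma>"
    unfolding legal_strategy_def
  proof (intro allI impI)
    fix h assume h: "distinct h \<and> set h \<subset> V"
    show "\<sigma> h \<in> V - set h"
    proof (cases "\<exists>w. R h w")
      case True
      then obtain w where w: "R h w" by blast
      then have "{last h, w} \<in> P" by (simp add: R_def)
      moreover have "\<forall>p\<in>P. p \<subseteq> V"
        using assms by (simp add: pairing_def)
      ultimately have "{last h, w} \<subseteq> V" by (rule bspec[rotated])
      then have "w \<in> V - set h"
        using w by (simp add: R_def)
      then show ?thesis using \<sigma>_eq[OF w] by simp
    next
      case False
      from h have "\<exists>v. v \<in> V - set h" by (intro psubset_imp_ex_mem) simp
      then have "(SOME v. v \<in> V - set h) \<in> V - set h" by (rule someI_ex)
      then show ?thesis using False by (simp add: \<sigma>_def)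
    qed
  qed
  moreover have "follows_pairing V P \<sigma>"
    unfolding follows_pairing_def by (intro allI impI \<sigma>_eq) (simp add: R_def)
  ultimately show ?thesis by blast
qed

lemma SC2_Max_welldefined:
  assumes "finite F"
  shows "finite {t. \<exists>P. pairing V P \<and> pairing_guarantees V F s P t}"
    and "{t. \<exists>P. pairing V P \<and> pairing_guarantees V F s P t} \<noteq> {}"
proof -
  have "t \<le> card F" if P: "pairing V P" and g: "pairing_guarantees V F s P t" for P t
  proof -
    obtain \<sigma> where \<sigma>: "legal_strategy V \<sigma>" "follows_pairing V P \<sigma>"
      using ex_strategy_following_pairing[OF P] by blast
    then have "t \<le> score F s (play \<sigma> \<sigma> (card V))"
      using g unfolding pairing_guarantees_def by blast
    also have "\<dots> \<le> card F"
      unfolding score_def using assms by (intro card_mono) auto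
    finally show ?thesis .
  qed
  then have "{t. \<exists>P. pairing V P \<and> pairing_guarantees V F s P t} \<subseteq> {..card F}" by auto
  then show "finite {t. \<exists>P. pairing V P \<and> pairing_guarantees V F s P t}"
    by (rule finite_subset) simp
  have "pairing V {}" "pairing_guarantees V F s {} 0"
    by (auto simp: pairing_def pairing_guarantees_def)
  then show "{t. \<exists>P. pairing V P \<and> pairing_guarantees V F s P t} \<noteq> {}" by blast
qed

lemma lp_feasible_ex:
  "\<exists>m. lp_feasible k l q m"
proof
  let ?m = "\<lambda>i. if i = k then 1 else 0 :: real"
  have fin: "finite (lp_indices k)" "k \<in> lp_indices k"
    by (auto simp: lp_indices_def)
  have "(\<Sum>i\<in>lp_indices k. real i * ?m i) = (\<Sum>i\<in>lp_indices k. if i = k then real k else 0)"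
    by (intro sum.cong) auto
  moreover have "real k * (real l - real q) / real l \<le> real k"
  proof (cases "l = 0")
    case False
    then show ?thesis by (simp add: pos_divide_le_eq mult_left_mono)
  qed simp
  ultimately show "lp_feasible k l q ?m"
    using fin by (simp add: lp_feasible_def)
qed

lemma lp_bdd_above:
  "bdd_above {(\<Sum>i\<in>lp_indices k. lp_coeff k s i * m i) | m. lp_feasible k l q m}"
proof (rule bdd_aboveI[of _ 1])
  fix x assume "x \<in> {(\<Sum>i\<in>lp_indices k. lp_coeff k s i * m i) | m. lp_feasible k l q m}"
  then obtain m where m: "lp_feasible k l q m"
    and x: "x = (\<Sum>i\<in>lp_indices k. lp_coeff k s i * m i)" by blast
  have "lp_coeff k s i * m i \<le> m i" if "i \<in> lp_indices k" for i
    using m that by (intro mult_left_le_one_le) (simp_all add: lp_feasible_def lp_coeff_def)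
  then have "x \<le> (\<Sum>i\<in>lp_indices k. m i)"
    unfolding x by (intro sum_mono)
  then show "x \<le> 1" using m by (simp add: lp_feasible_def)
qed

text \<open>
  On a board with an odd number of vertices Maker claims one vertex more than Breaker, and already
  for a single vertex (with \<open>k = l = n = s = 1\<close>) this takes her above the optimum of the linear
  program. Hence the assumption \<open>even (card V)\<close> in the theorem.
\<close>

lemma odd_board_exceeds_lp_optimum:
  "real (SC2 {v} {{v}} 1) > lp_optimum 1 1 q 1 * 1"
proof -
  have "pairing_guarantees {v} {{v}} 1 {} 1"
    unfolding pairing_guarantees_def
  proof (intro allI impI)
    fix \<sigma> \<tau>
    assume "legal_strategy {v} \<sigma> \<and> follows_pairing {v} {} \<sigma> \<and> legal_strategy {v} \<tau>"
    then have "legal_strategy {v} \<sigma>" by blast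
    from this[unfolded legal_strategy_def, rule_format, of "[]"]
    have "\<sigma> [] = v" by auto
    then have "play \<sigma> \<tau> (card {v}) = [v]" by simp
    moreover have "maker_claimed [v] = {v}" by (auto simp: maker_claimed_def)
    moreover have "{e \<in> {{v}}. 1 \<le> card (e \<inter> {v})} = {{v}}" by auto
    ultimately show "1 \<le> score {{v}} 1 (play \<sigma> \<tau> (card {v}))"
      by (simp add: score_def)
  qed
  moreover have "pairing {v} {}" by (simp add: pairing_def)
  ultimately have SC2: "1 \<le> SC2 {v} {{v}} 1"
    unfolding SC2_def by (intro Max_ge SC2_Max_welldefined(1)) auto
  have I: "lp_indices 1 = {1}"
  proof -
    have "i = 1" if "i \<le> 1" "i mod 2 = 1" for i :: nat
      using that by presburger
    then show ?thesis by (auto simp: lp_indices_def)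
  qed
  have "lp_coeff 1 1 1 = measure_pmf.prob (binomial_pmf 1 (1/2)) {x. 1 \<le> x}"
    by (simp add: lp_coeff_def)
  also have "\<dots> = pmf (binomial_pmf 1 (1/2)) 1"
  proof -
    have "{x. 1 \<le> x} \<inter> set_pmf (binomial_pmf 1 (1/2)) = {1::nat}"
      by auto
    then show ?thesis
      by (metis measure_Int_set_pmf measure_pmf_single)
  qed
  also have "\<dots> = 1 / 2" by simp
  finally have c: "lp_coeff 1 1 1 = 1 / 2" .
  have "lp_optimum 1 1 q 1 \<le> 1 / 2"
    unfolding lp_optimum_def
  proof (rule cSup_least)
    show "{(\<Sum>i\<in>lp_indices 1. lp_coeff 1 1 i * m i) | m. lp_feasible 1 1 q m} \<noteq> {}"
      using lp_feasible_ex[of 1 1 q] by blast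
    fix x assume "x \<in> {(\<Sum>i\<in>lp_indices 1. lp_coeff 1 1 i * m i) | m. lp_feasible 1 1 q m}"
    then obtain m where m: "lp_feasible 1 1 q m"
      and x: "x = (\<Sum>i\<in>lp_indices 1. lp_coeff 1 1 i * m i)" by blast
    from m have "m 1 = 1" by (simp only: lp_feasible_def I) simp
    then show "x \<le> 1 / 2" by (simp only: x I c sum.insert) (simp add: c[simplified])
  qed
  then show ?thesis using SC2 by linarith
qed

end

theory Submission
  imports Defs
begin

text \<open>
  Extend the pairs to a perfect matching \<open>f\<close> of the vertices. Maker's free moves being arbitrary,
  she may be confined to any prescribed set \<open>T\<close> containing one vertex of each pair, so the score
  she guarantees is at most the average score over all such \<open>T\<close>. A winning set with exactly \<open>i\<close>
  vertices whose partners lie outside it meets a uniformly random \<open>T\<close> in \<open>(k - i) / 2 + X\<^sub>i\<close> vertices.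
  Hence the average is \<open>n\<close> times the LP objective at \<open>m\<close>, where \<open>m i\<close> is the fraction of winning
  sets with parameter \<open>i\<close>; counting the winning sets that contain both vertices of a pair shows
  that \<open>m\<close> is feasible.
\<close>

section \<open>Perfect matchings and their transversals\<close>

text \<open>A matching is encoded as a fixed-point-free involution of \<open>V\<close>, so that the
  partner of \<open>x\<close> is \<open>f x\<close>; values outside \<open>V\<close> are
  unconstrained.\<close>

definition perfect_matching :: "'a set \<Rightarrow> ('a \<Rightarrow> 'a) \<Rightarrow> bool" where
  "perfect_matching V f \<longleftrightarrow> (\<forall>x\<in>V. f x \<in> V \<and> f x \<noteq> x \<and> f (f x) = x)"

definition transversals :: "'a set \<Rightarrow> ('a \<Rightarrow> 'a) \<Rightarrow> 'a set set" where
  "transversals V f = {T. T \<subseteq> V \<and> (\<forall>x\<in>V. x \<in> T \<longleftrightarrow> f x \<notin> T)}"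

lemma perfect_matchingD:
  assumes "perfect_matching V f" "x \<in> V"
  shows "f x \<in> V" "f x \<noteq> x" "f (f x) = x"
  using assms by (auto simp: perfect_matching_def)

text \<open>The involution swaps two halves of \<open>U\<close> along a bijection between
  them.\<close>

lemma ex_perfect_matching:
  assumes "finite U" "even (card U)"
  shows "\<exists>f. perfect_matching U f"
proof -
  obtain T where T: "T \<subseteq> U" "card T = card U div 2"
    by (meson obtain_subset_with_card_n div_le_dividend)
  have "card (U - T) = card T"
    using T assms by (auto simp: card_Diff_subset finite_subset elim: evenE)
  then obtain g where g: "bij_betw g T (U - T)"
    using T assms by (metis bij_betw_iff_card finite_Diff finite_subset)
  define f where "f x = (if x \<in> T then g x else inv_into T g x)" for x
  have 1: "f x \<in> U - T" "f (f x) = x" if "x \<in> T" for x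
    using g that by (auto simp: f_def bij_betw_def)
  have 2: "f x \<in> T" "f (f x) = x" if "x \<in> U - T" for x
  proof -
    have "f x = inv_into T g x" using that by (simp add: f_def)
    then show "f x \<in> T" "f (f x) = x"
      using g that by (simp_all add: bij_betw_def inv_into_into f_inv_into_f f_def)
  qed
  have "perfect_matching U f"
    unfolding perfect_matching_def using 1 2 T by (metis DiffD1 DiffD2 DiffI subsetD)
  then show ?thesis by blast
qed

text \<open>Disjoint pairs cover an even number of vertices, so on a board of even size the
  uncovered vertices are even in number and can be matched among themselves.\<close>

lemma pairing_extends_to_perfect_matching:
  assumes P: "pairing V P" and V: "finite V" "even (card V)"
  obtains f where "perfect_matching V f" "\<And>v w. {v, w} \<in> P \<Longrightarrow> f v = w"
proof -
  have P': "p \<subseteq> V" "card p = 2" if "p \<in> P" for p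
    using P that by (auto simp: pairing_def)
  have disj: "p = p'" if "p \<in> P" "p' \<in> P" "x \<in> p" "x \<in> p'" for p p' x
    using P that unfolding pairing_def pairwise_def disjnt_def by blast
  define U where "U = V - \<Union>P"
  have "card (\<Union>P) = (\<Sum>p\<in>P. card p)"
    using P P' V by (intro card_Union_disjoint)
      (auto simp: pairing_def intro: finite_subset)
  then have "even (card (\<Union>P))" using P' by simp
  moreover have "\<Union>P \<subseteq> V" using P' by blast
  ultimately have "even (card U)"
    using V by (simp add: U_def card_Diff_subset finite_subset card_mono)
  then obtain g where g: "perfect_matching U g"
    using ex_perfect_matching V by (metis U_def finite_Diff)
  \<comment> \<open>Disjointness of the pairs makes the partner of a covered vertex unique, so
    \<open>THE\<close> is meaningful here.\<close>
  define f where "f v = (if v \<in> \<Union>P then THE w. {v, w} \<in> P else g v)" for v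
  have f: "f v = w" if "{v, w} \<in> P" for v w
  proof -
    have "(THE w. {v, w} \<in> P) = w"
    proof (rule the_equality)
      show "{v, w} \<in> P" by fact
      show "w' = w" if "{v, w'} \<in> P" for w'
        using disj[OF that \<open>{v, w} \<in> P\<close>, of v] by (auto simp: doubleton_eq_iff)
    qed
    then show ?thesis using that by (auto simp: f_def)
  qed
  have "f v \<in> V \<and> f v \<noteq> v \<and> f (f v) = v" if v: "v \<in> V" for v
  proof (cases "v \<in> \<Union>P")
    case True
    then obtain p where p: "p \<in> P" "v \<in> p" by blast
    then obtain w where w: "p = {v, w}" "v \<noteq> w"
      using P'(2)[OF p(1)] by (auto simp: card_2_iff)
    then have "f v = w" "f w = v"
      using f[of v w] f[of w v] p by (auto simp: insert_commute)
    then show ?thesis using w P'(1)[OF p(1)] by auto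
  next
    case False
    then have "v \<in> U" using v by (simp add: U_def)
    then have "g v \<in> U" "g v \<noteq> v" "g (g v) = v"
      using perfect_matchingD[OF g] by blast+
    then show ?thesis using False by (auto simp: f_def U_def)
  qed
  then have "perfect_matching V f" by (simp add: perfect_matching_def)
  then show ?thesis using f that by blast
qed

lemma finite_transversals: "finite V \<Longrightarrow> finite (transversals V f)"
  by (rule finite_subset[of _ "Pow V"]) (auto simp: transversals_def)

lemma transversals_nonempty:
  assumes f: "perfect_matching V f"
  shows "transversals V f \<noteq> {}"
proof -
  \<comment> \<open>The choice is made from the set \<open>{x, f x}\<close>, which is the same for
    both partners; hence they get the same representative, and the representatives form a
    transversal.\<close>
  define c where "c x = (SOME y. y \<in> {x, f x})" for x
  have c: "c x \<in> {x, f x}" for x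
    unfolding c_def by (rule someI[of _ x]) simp
  have cf: "c (f x) = c x" if "x \<in> V" for x
    using perfect_matchingD[OF f that] by (simp add: c_def insert_commute)
  have fixed: "c x = x" if x: "x \<in> c ` V" for x
  proof -
    obtain u where "u \<in> V" "x = c u" using x by blast
    then show ?thesis using c[of u] cf[of u] by auto
  qed
  have "c ` V \<subseteq> V"
  proof
    fix x assume "x \<in> c ` V"
    then obtain u where "u \<in> V" "x = c u" by blast
    then show "x \<in> V" using c[of u] perfect_matchingD(1)[OF f] by auto
  qed
  moreover have "x \<in> c ` V \<longleftrightarrow> f x \<notin> c ` V" if x: "x \<in> V" for x
  proof
    assume "x \<in> c ` V"
    then show "f x \<notin> c ` V"
      using fixed[of x] fixed[of "f x"] cf[OF x] perfect_matchingD[OF f x] by auto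
  next
    assume "f x \<notin> c ` V"
    then show "x \<in> c ` V" using c[of x] x by (metis imageI insertE singletonD)
  qed
  ultimately have "c ` V \<in> transversals V f" by (simp add: transversals_def)
  then show ?thesis by blast
qed

text \<open>\<open>f\<close> exchanges \<open>W \<inter> T\<close> and \<open>W - T\<close>.\<close>

lemma card_closed_Int_transversal:
  assumes f: "perfect_matching V f" and T: "T \<in> transversals V f"
    and W: "finite W" "W \<subseteq> V" "\<And>x. x \<in> W \<Longrightarrow> f x \<in> W"
  shows "2 * card (W \<inter> T) = card W"
proof -
  have T': "x \<in> T \<longleftrightarrow> f x \<notin> T" if "x \<in> W" for x
    using T W that by (auto simp: transversals_def)
  have ff: "f (f x) = x" if "x \<in> W" for x
    using perfect_matchingD[OF f] W that by blast
  have "bij_betw f (W \<inter> T) (W - T)"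
    by (rule bij_betw_byWitness[where f' = f]) (use T' ff W in auto)
  then have "card (W \<inter> T) = card (W - T)" by (rule bij_betw_same_card)
  moreover have "card W = card (W \<inter> T) + card (W - T)"
    using W by (metis card_Int_Diff)
  ultimately show ?thesis by simp
qed

text \<open>Re-choosing within the pairs that meet \<open>S\<close> maps one fibre of \<open>T \<mapsto> T \<inter> S\<close> injectively into
  another, so all fibres have the same size.\<close>

lemma card_transversals_Int:
  assumes V: "finite V" and f: "perfect_matching V f"
    and S: "S \<subseteq> V" "\<And>x. x \<in> S \<Longrightarrow> f x \<notin> S"
  shows "card {T \<in> transversals V f. Q (T \<inter> S)} * 2 ^ card S =
    card (transversals V f) * card {A. A \<subseteq> S \<and> Q A}"
proof -
  let ?X = "transversals V f"
  define fib where "fib A = {T \<in> ?X. T \<inter> S = A}" for A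
  have fin: "finite (fib A)" for A using finite_transversals[OF V] by (simp add: fib_def)
  have finS: "finite S" using S V finite_subset by blast
  have le: "card (fib A) \<le> card (fib B)" if A: "A \<subseteq> S" and B: "B \<subseteq> S" for A B
  proof (rule card_inj_on_le)
    \<comment> \<open>\<open>?g\<close> prescribes the trace \<open>B\<close> on \<open>S\<close>,
      makes the complementary choice on the partners of \<open>S\<close>, and keeps \<open>T\<close>
      on all other pairs.\<close>
    let ?g = "\<lambda>T. {x \<in> V. if x \<in> S then x \<in> B else if f x \<in> S then f x \<notin> B else x \<in> T}"
    show "finite (fib B)" by (rule fin)
    show "?g ` fib A \<subseteq> fib B"
      using S B perfect_matchingD[OF f]
      by (auto simp: fib_def transversals_def split: if_splits)
    show "inj_on ?g (fib A)"
    proof (rule inj_onI)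
      fix T T' assume T: "T \<in> fib A" "T' \<in> fib A" and eq: "?g T = ?g T'"
      \<comment> \<open>\<open>T\<close> and \<open>T'\<close> both have trace \<open>A\<close> on
        \<open>S\<close>, hence also agree on the partners of \<open>S\<close>; everywhere else
        \<open>?g\<close> copies them.\<close>
      have *: "x \<in> T \<longleftrightarrow> x \<in> T'" if x: "x \<in> V" for x
      proof -
        consider "x \<in> S" | "f x \<in> S" | "x \<notin> S" "f x \<notin> S" by blast
        then show ?thesis
        proof cases
          case 1 then show ?thesis using T by (auto simp: fib_def)
        next
          case 2 then have "f x \<in> T \<longleftrightarrow> f x \<in> T'" using T by (auto simp: fib_def)
          then show ?thesis using T x by (auto simp: fib_def transversals_def)
        next
          case 3
          have "x \<in> ?g T \<longleftrightarrow> x \<in> ?g T'" using eq by (rule arg_cong)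
          then show ?thesis using 3 x by simp
        qed
      qed
      show "T = T'" using T * by (auto simp: fib_def transversals_def)
    qed
  qed
  define N where "N = card (fib {})"
  have N: "card (fib A) = N" if "A \<subseteq> S" for A
    using le[of A "{}"] le[of "{}" A] that by (simp add: N_def)
  have count: "card {T \<in> ?X. R (T \<inter> S)} = N * card {A. A \<subseteq> S \<and> R A}" for R
  proof -
    have "{T \<in> ?X. R (T \<inter> S)} = (\<Union>A\<in>{A. A \<subseteq> S \<and> R A}. fib A)"
      by (auto simp: fib_def)
    also have "card \<dots> = (\<Sum>A\<in>{A. A \<subseteq> S \<and> R A}. card (fib A))"
      using finS fin by (intro card_UN_disjoint) (auto simp: fib_def)
    also have "\<dots> = N * card {A. A \<subseteq> S \<and> R A}" using N by simp
    finally show ?thesis .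
  qed
  \<comment> \<open>The trivial predicate counts all transversals, which ties the common fibre size
    \<open>N\<close> to their number.\<close>
  have "card ?X = N * 2 ^ card S"
    using count[of "\<lambda>_. True"] card_Pow[OF finS] by (simp add: Pow_def)
  then show ?thesis using count[of Q] by simp
qed

section \<open>The coefficients of the program as proportions of transversals\<close>

text \<open>A uniformly random subset of \<open>S\<close> arises from an independent fair coin toss
  for each element.\<close>

lemma map_pmf_card_Pow:
  assumes "finite S"
  shows "map_pmf card (pmf_of_set (Pow S)) = binomial_pmf (card S) (1/2)"
proof -
  have "binomial_pmf (card S) (1/2) =
      map_pmf (\<lambda>g. card {x \<in> S. g x}) (Pi_pmf S True (\<lambda>_. bernoulli_pmf (1/2)))"
    using assms by (intro binomial_pmf_altdef') auto
  also have "\<dots> = map_pmf card (map_pmf (\<lambda>g. {x \<in> S. g x}) (Pi_pmf S True (\<lambda>_. bernoulli_pmf (1/2))))"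
    by (simp add: map_pmf_comp)
  finally show ?thesis using assms by (simp add: pmf_of_set_Pow_conv_bernoulli)
qed

text \<open>To be applied with \<open>d\<close> the number of pairs inside a winning set,
  \<open>S\<close> its vertices with partner outside, and \<open>A\<close> the trace of a
  transversal on \<open>S\<close>.\<close>

lemma lp_coeff_eq_card:
  assumes "finite S" "k = card S + 2 * d"
  shows "lp_coeff k s (card S) = card {A. A \<subseteq> S \<and> s \<le> d + card A} / 2 ^ card S"
proof -
  have "(real k - real (card S)) / 2 + real x \<ge> real s \<longleftrightarrow> s \<le> d + x" for x
    using assms(2) by auto
  then have "lp_coeff k s (card S) = measure_pmf.prob (binomial_pmf (card S) (1/2)) {x. s \<le> d + x}"
    by (simp add: lp_coeff_def)
  also have "\<dots> = measure_pmf.prob (pmf_of_set (Pow S)) {A. s \<le> d + card A}"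
    by (simp flip: map_pmf_card_Pow[OF assms(1)] add: vimage_def)
  also have "\<dots> = card (Pow S \<inter> {A. s \<le> d + card A}) / card (Pow S)"
    using assms by (intro measure_pmf_of_set) auto
  also have "Pow S \<inter> {A. s \<le> d + card A} = {A. A \<subseteq> S \<and> s \<le> d + card A}" by auto
  finally show ?thesis using assms by (simp add: card_Pow)
qed

text \<open>The part \<open>W\<close> of \<open>e\<close> that is closed under \<open>f\<close>
  contributes half its vertices to every transversal, while on the rest \<open>S\<close> all
  \<open>2 ^ card S\<close> traces are equally frequent.\<close>

lemma card_transversals_hitting:
  assumes V: "finite V" and f: "perfect_matching V f" and e: "e \<subseteq> V"
  defines "i \<equiv> card {v \<in> e. f v \<notin> e}"
  shows "i \<in> lp_indices (card e)"
    and "real (card {T \<in> transversals V f. s \<le> card (e \<inter> T)}) =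
      lp_coeff (card e) s i * card (transversals V f)"
proof -
  define S where "S = {v \<in> e. f v \<notin> e}"
  define W where "W = e - S"
  have fin: "finite e" "finite S" "finite W"
    using V e by (auto simp: S_def W_def intro: finite_subset)
  have cl: "f x \<in> W" if "x \<in> W" for x
    using that e perfect_matchingD[OF f] by (auto simp: S_def W_def)
  \<comment> \<open>\<open>d\<close> is the number of pairs inside \<open>e\<close>. That
    \<open>card W\<close> is even is read off from a single transversal, so one has to
    exist.\<close>
  obtain d where d: "\<And>T. T \<in> transversals V f \<Longrightarrow> card (W \<inter> T) = d" "card W = 2 * d"
  proof -
    have "2 * card (W \<inter> T) = card W" if "T \<in> transversals V f" for T
      using card_closed_Int_transversal[OF f that fin(3) _ cl] e by (auto simp: W_def)
    then show ?thesis using that[of "card W div 2"] transversals_nonempty[OF f]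
      by (metis all_not_in_conv nonzero_mult_div_cancel_left zero_neq_numeral)
  qed
  have e_eq: "e = S \<union> W" "S \<inter> W = {}" by (auto simp: S_def W_def)
  have k: "card e = card S + 2 * d"
    using d fin e_eq by (metis card_Un_disjoint)
  then show "i \<in> lp_indices (card e)" by (simp add: lp_indices_def i_def S_def)
  have "card (e \<inter> T) = d + card (T \<inter> S)" if "T \<in> transversals V f" for T
  proof -
    have "e \<inter> T = (T \<inter> S) \<union> (W \<inter> T)" using e_eq by blast
    moreover have "(T \<inter> S) \<inter> (W \<inter> T) = {}" using e_eq by blast
    ultimately show ?thesis using fin d(1)[OF that]
      by (simp add: card_Un_disjoint)
  qed
  then have "{T \<in> transversals V f. s \<le> card (e \<inter> T)} =
      {T \<in> transversals V f. s \<le> d + card (T \<inter> S)}" by auto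
  moreover have "card {T \<in> transversals V f. s \<le> d + card (T \<inter> S)} * 2 ^ card S =
      card (transversals V f) * card {A. A \<subseteq> S \<and> s \<le> d + card A}"
    using e by (intro card_transversals_Int[OF V f]) (auto simp: S_def)
  then have "real (card {T \<in> transversals V f. s \<le> d + card (T \<inter> S)}) * 2 ^ card S =
      real (card (transversals V f)) * real (card {A. A \<subseteq> S \<and> s \<le> d + card A})"
    by (metis (no_types, lifting) of_nat_mult of_nat_numeral of_nat_power)
  then have "real (card {T \<in> transversals V f. s \<le> d + card (T \<inter> S)}) =
      card {A. A \<subseteq> S \<and> s \<le> d + card A} / 2 ^ card S * card (transversals V f)"
    by (simp add: eq_divide_eq mult.commute)
  ultimately show "real (card {T \<in> transversals V f. s \<le> card (e \<inter> T)}) =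
      lp_coeff (card e) s i * card (transversals V f)"
    using lp_coeff_eq_card[OF fin(2) k, of s]
    by (simp add: i_def S_def[symmetric])
qed

section \<open>A play that keeps Maker's vertices inside a transversal\<close>

lemma maker_claimed_append:
  fixes h :: "'a list"
  shows "maker_claimed (h @ [v]) = maker_claimed h \<union> (if even (length h) then {v} else {})"
proof -
  have "{i. i < length (h @ [v]) \<and> even i} =
      {i. i < length h \<and> even i} \<union> (if even (length h) then {length h} else {})"
    by (auto simp: less_Suc_eq)
  moreover have "maker_claimed g = (!) g ` {i. i < length g \<and> even i}" for g :: "'a list"
    by (auto simp: maker_claimed_def)
  moreover have "(!) (h @ [v]) ` {i. i < length h \<and> even i} = (!) h ` {i. i < length h \<and> even i}"
    by (intro image_cong) (auto simp: nth_append)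
  ultimately show ?thesis by (simp add: image_Un)
qed

text \<open>Maker's free moves are arbitrary, so she may be taken to spend them on \<open>T\<close>. Breaker always
  answers with the partner, and no response is ever forced.\<close>

lemma play_within_transversal:
  assumes V: "finite V" "even (card V)" and P: "pairing V P"
    and f: "perfect_matching V f" and fP: "\<And>v w. {v, w} \<in> P \<Longrightarrow> f v = w"
    and T: "T \<in> transversals V f"
  shows "\<exists>\<sigma> \<tau>. legal_strategy V \<sigma> \<and> follows_pairing V P \<sigma> \<and> legal_strategy V \<tau> \<and>
    maker_claimed (play \<sigma> \<tau> (card V)) \<subseteq> T"
proof -
  obtain \<rho> where \<rho>: "legal_strategy V \<rho>" "follows_pairing V P \<rho>"
    using ex_strategy_following_pairing[OF P] by blast
  define closed where "closed h \<longleftrightarrow> (\<forall>v\<in>set h. f v \<in> set h)" for h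
  \<comment> \<open>Maker moves into \<open>T\<close> only when no pair is half claimed. A pending
    response leaves its pair half claimed, so then \<open>\<rho>\<close> takes over and obeys
    \<open>P\<close>.\<close>
  define \<sigma> where "\<sigma> h = (if closed h \<and> T - set h \<noteq> {} then SOME v. v \<in> T - set h else \<rho> h)" for h
  \<comment> \<open>Breaker completes the pair just opened; \<open>\<rho>\<close> only supplies
    legal moves in positions where there is no such pair.\<close>
  define \<tau> where "\<tau> h = (if h \<noteq> [] \<and> f (last h) \<notin> set h then f (last h) else \<rho> h)" for h
  have \<sigma>_in: "\<sigma> h \<in> T - set h" if "closed h" "T - set h \<noteq> {}" for h
    using that someI_ex[of "\<lambda>v. v \<in> T - set h"] unfolding \<sigma>_def by auto
  have "T \<subseteq> V" using T by (simp add: transversals_def)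
  have "legal_strategy V \<sigma>"
    unfolding legal_strategy_def
  proof (intro allI impI)
    fix h assume h: "distinct h \<and> set h \<subset> V"
    show "\<sigma> h \<in> V - set h"
    proof (cases "closed h \<and> T - set h \<noteq> {}")
      case True
      then show ?thesis using \<sigma>_in[of h] \<open>T \<subseteq> V\<close> by blast
    next
      case False
      then have "\<sigma> h = \<rho> h" unfolding \<sigma>_def by (rule if_not_P)
      then show ?thesis using h \<rho>(1) by (simp add: legal_strategy_def)
    qed
  qed
  moreover have "follows_pairing V P \<sigma>"
    unfolding follows_pairing_def
  proof (intro allI impI)
    fix h v w
    assume *: "distinct (h @ [v]) \<and> set (h @ [v]) \<subseteq> V \<and> odd (length h) \<and>
        {v, w} \<in> P \<and> w \<notin> set (h @ [v])"
    then have "\<not> closed (h @ [v])" using fP[of v w] by (auto simp: closed_def)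
    then have "\<sigma> (h @ [v]) = \<rho> (h @ [v])" by (simp add: \<sigma>_def)
    also have "\<dots> = w" using * \<rho>(2) unfolding follows_pairing_def by blast
    finally show "\<sigma> (h @ [v]) = w" .
  qed
  moreover have "legal_strategy V \<tau>"
    unfolding legal_strategy_def
  proof (intro allI impI)
    fix h assume h: "distinct h \<and> set h \<subset> V"
    have "f (last h) \<in> V" if "h \<noteq> []"
      using h that perfect_matchingD(1)[OF f, of "last h"] last_in_set[OF that] by blast
    then show "\<tau> h \<in> V - set h"
      using h \<rho>(1) by (auto simp: \<tau>_def legal_strategy_def)
  qed
  moreover have "maker_claimed (play \<sigma> \<tau> (card V)) \<subseteq> T"
  proof -
    \<comment> \<open>The invariant is stated after complete rounds, when Breaker has just closed
      the pair opened by Maker.\<close>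
    have inv: "length h = 2 * j \<and> distinct h \<and> set h \<subseteq> V \<and> closed h \<and> maker_claimed h \<subseteq> T"
      if "2 * j \<le> card V" "h = play \<sigma> \<tau> (2 * j)" for j h
      using that
    proof (induction j arbitrary: h)
      case 0
      then show ?case by (simp add: closed_def maker_claimed_def)
    next
      case (Suc j)
      define g where "g = play \<sigma> \<tau> (2 * j)"
      have g: "length g = 2 * j" "distinct g" "set g \<subseteq> V" "closed g" "maker_claimed g \<subseteq> T"
        using Suc.IH[of g] Suc.prems by (simp_all add: g_def)
      have "card (set g) < card V" using g Suc.prems by (simp add: distinct_card)
      \<comment> \<open>An unclaimed \<open>x\<close> has an unclaimed partner because the position
        is closed, and one of the two lies in \<open>T\<close>; so Maker can still move inside
        \<open>T\<close>.\<close>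
      then obtain x where x: "x \<in> V" "x \<notin> set g"
        using g(3) by (metis less_irrefl subsetI subset_antisym)
      have fx: "f x \<notin> set g"
        using x g(4) perfect_matchingD(3)[OF f x(1)] by (auto simp: closed_def)
      have "x \<in> T \<or> f x \<in> T" using T x by (auto simp: transversals_def)
      then have "T - set g \<noteq> {}" using x fx by blast
      define v where "v = \<sigma> g"
      have v: "v \<in> T" "v \<notin> set g" "v \<in> V"
        using \<sigma>_in[OF g(4) \<open>T - set g \<noteq> {}\<close>] \<open>T \<subseteq> V\<close> by (auto simp: v_def)
      have fv: "f v \<in> V" "f v \<noteq> v" "f (f v) = v"
        using perfect_matchingD[OF f v(3)] by auto
      have "f v \<notin> set g" using fv v g(4) by (auto simp: closed_def)
      then have "\<tau> (g @ [v]) = f v" using fv by (simp add: \<tau>_def)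
      moreover have "play \<sigma> \<tau> (2 * Suc j) = (g @ [v]) @ [\<tau> (g @ [v])]"
        by (simp add: g_def v_def)
      ultimately have h: "h = (g @ [v]) @ [f v]" unfolding Suc.prems(2) by (simp only:)
      then have "maker_claimed h \<subseteq> T"
        unfolding h maker_claimed_append using g v by simp
      then show ?case
        using h g v fv \<open>f v \<notin> set g\<close> unfolding closed_def by simp
    qed
    \<comment> \<open>A board of even size is exhausted by complete rounds, so the invariant reaches
      the final position.\<close>
    then show ?thesis using V(2) by (metis dvd_mult_div_cancel order_refl)
  qed
  ultimately show ?thesis by blast
qed

section \<open>Averaging over transversals and the linear program\<close>

text \<open>Every transversal contains all of Maker's vertices in some admissible play, so at least
  \<open>t\<close> winning sets meet it in \<open>s\<close> or more vertices. Summing over the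
  transversals and exchanging the sums gives the average.\<close>

lemma pairing_guarantee_le_average:
  assumes V: "finite V" "even (card V)" and F: "finite F" "\<And>e. e \<in> F \<Longrightarrow> e \<subseteq> V" "\<And>e. e \<in> F \<Longrightarrow> card e = k"
    and P: "pairing V P" and f: "perfect_matching V f" and fP: "\<And>v w. {v, w} \<in> P \<Longrightarrow> f v = w"
    and t: "pairing_guarantees V F s P t"
  shows "real t \<le> (\<Sum>e\<in>F. lp_coeff k s (card {v \<in> e. f v \<notin> e}))"
proof -
  let ?X = "transversals V f"
  have fin: "finite ?X" using V by (simp add: finite_transversals)
  have le: "t \<le> card {e \<in> F. s \<le> card (e \<inter> T)}" if T: "T \<in> ?X" for T
  proof -
    obtain \<sigma> \<tau> where "legal_strategy V \<sigma>" "follows_pairing V P \<sigma>" "legal_strategy V \<tau>"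
      and sub: "maker_claimed (play \<sigma> \<tau> (card V)) \<subseteq> T"
      using play_within_transversal[OF V P f fP T] by blast
    then have "t \<le> score F s (play \<sigma> \<tau> (card V))"
      using t by (auto simp: pairing_guarantees_def)
    also have "\<dots> \<le> card {e \<in> F. s \<le> card (e \<inter> T)}"
      unfolding score_def
    proof (intro card_mono)
      show "finite {e \<in> F. s \<le> card (e \<inter> T)}" using F by simp
    next
      show "{e \<in> F. s \<le> card (e \<inter> maker_claimed (play \<sigma> \<tau> (card V)))} \<subseteq> {e \<in> F. s \<le> card (e \<inter> T)}"
      proof
        fix e assume e: "e \<in> {e \<in> F. s \<le> card (e \<inter> maker_claimed (play \<sigma> \<tau> (card V)))}"
        then have "finite e" using F V finite_subset by blast
        then have "card (e \<inter> maker_claimed (play \<sigma> \<tau> (card V))) \<le> card (e \<inter> T)"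
          using sub by (intro card_mono) auto
        then show "e \<in> {e \<in> F. s \<le> card (e \<inter> T)}" using e by simp
      qed
    qed
    finally show ?thesis .
  qed
  have "t * card ?X \<le> (\<Sum>T\<in>?X. card {e \<in> F. s \<le> card (e \<inter> T)})"
    using sum_mono[of ?X "\<lambda>_. t", OF le] by (simp add: mult.commute)
  also have "\<dots> = (\<Sum>e\<in>F. card {T \<in> ?X. s \<le> card (e \<inter> T)})"
    using fin F(1) by (rule sum_multicount_gen) simp
  finally have "real (t * card ?X) \<le> (\<Sum>e\<in>F. real (card {T \<in> ?X. s \<le> card (e \<inter> T)}))"
    by (simp flip: of_nat_sum of_nat_mult)
  also have "\<dots> = (\<Sum>e\<in>F. lp_coeff k s (card {v \<in> e. f v \<notin> e})) * card ?X"
    unfolding sum_distrib_right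
    using card_transversals_hitting(2)[OF V(1) f F(2)] F(3) by (intro sum.cong) simp_all
  finally show ?thesis
    using fin transversals_nonempty[OF f] by (simp add: card_gt_0_iff)
qed

text \<open>Each vertex lies together with its partner in at most \<open>q\<close> winning sets, so
  at most \<open>q * card V\<close> of the \<open>k * card F\<close> incidences belong to pairs
  inside a winning set. The additive form avoids truncated subtraction.\<close>

lemma sum_singles_ge:
  assumes V: "finite V" and f: "perfect_matching V f"
    and F: "finite F" "\<And>e. e \<in> F \<Longrightarrow> e \<subseteq> V" "\<And>e. e \<in> F \<Longrightarrow> card e = k"
    and q: "\<And>u v. u \<in> V \<Longrightarrow> v \<in> V \<Longrightarrow> u \<noteq> v \<Longrightarrow> card {e \<in> F. u \<in> e \<and> v \<in> e} \<le> q"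
  shows "k * card F \<le> (\<Sum>e\<in>F. card {v \<in> e. f v \<notin> e}) + q * card V"
proof -
  have "(\<Sum>e\<in>F. card {v \<in> e. f v \<in> e}) = (\<Sum>e\<in>F. card {v \<in> V. v \<in> e \<and> f v \<in> e})"
    using F by (intro sum.cong arg_cong[of _ _ card]) auto
  also have "\<dots> = (\<Sum>v\<in>V. card {e \<in> F. v \<in> e \<and> f v \<in> e})"
    using F(1) V by (rule sum_multicount_gen) simp
  also have "\<dots> \<le> (\<Sum>v\<in>V. q)"
    using q perfect_matchingD[OF f] by (intro sum_mono) metis
  finally have "(\<Sum>e\<in>F. card {v \<in> e. f v \<in> e}) \<le> q * card V" by (simp add: mult.commute)
  moreover have "card e = card {v \<in> e. f v \<notin> e} + card {v \<in> e. f v \<in> e}" if "e \<in> F" for e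
  proof -
    have "finite e" using F V that finite_subset by blast
    then have "card ({v \<in> e. f v \<notin> e} \<union> {v \<in> e. f v \<in> e}) =
        card {v \<in> e. f v \<notin> e} + card {v \<in> e. f v \<in> e}"
      by (intro card_Un_disjoint) auto
    then show ?thesis by (simp flip: Collect_disj_eq conj_disj_distribL)
  qed
  then have "(\<Sum>e\<in>F. k) = (\<Sum>e\<in>F. card {v \<in> e. f v \<notin> e} + card {v \<in> e. f v \<in> e})"
    using F(3) by (intro sum.cong) auto
  ultimately show ?thesis by (simp add: sum.distrib mult.commute)
qed

text \<open>The distribution of \<open>c\<close> over \<open>F\<close> is a feasible point whose
  objective value is the average coefficient.\<close>

lemma average_le_lp_optimum:
  assumes F: "finite F" "F \<noteq> {}" and c: "\<And>e. e \<in> F \<Longrightarrow> c e \<in> lp_indices k"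
    and ge: "real k * (real l - real q) / real l * card F \<le> (\<Sum>e\<in>F. real (c e))"
  shows "(\<Sum>e\<in>F. lp_coeff k s (c e)) \<le> lp_optimum k l q s * card F"
proof -
  define m where "m i = card {e \<in> F. c e = i} / card F" for i
  have n: "real (card F) > 0" using F by (simp add: card_gt_0_iff)
  have I: "finite (lp_indices k)" by (simp add: lp_indices_def)
  \<comment> \<open>Expectation under \<open>m\<close> equals the average over \<open>F\<close>. It
    serves three times: for the normalisation, the constraint and the objective.\<close>
  have avg: "(\<Sum>i\<in>lp_indices k. g i * m i) = (\<Sum>e\<in>F. g (c e)) / card F" for g :: "nat \<Rightarrow> real"
  proof -
    have "(\<Sum>i\<in>lp_indices k. g i * m i) = (\<Sum>i\<in>lp_indices k. \<Sum>e | e \<in> F \<and> c e = i. g (c e)) / card F"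
      by (simp add: m_def sum_divide_distrib mult.commute)
    also have "(\<Sum>i\<in>lp_indices k. \<Sum>e | e \<in> F \<and> c e = i. g (c e)) = (\<Sum>e\<in>F. g (c e))"
      using F I c by (intro sum.group) auto
    finally show ?thesis .
  qed
  have "lp_feasible k l q m"
    unfolding lp_feasible_def
  proof (intro conjI ballI)
    show "(\<Sum>i\<in>lp_indices k. m i) = 1" using avg[of "\<lambda>_. 1"] n by simp
    show "real k * (real l - real q) / real l \<le> (\<Sum>i\<in>lp_indices k. real i * m i)"
      unfolding avg pos_le_divide_eq[OF n] by (rule ge)
    show "0 \<le> m i" for i by (simp add: m_def)
  qed
  then have "(\<Sum>i\<in>lp_indices k. lp_coeff k s i * m i) \<le> lp_optimum k l q s"
    unfolding lp_optimum_def by (intro cSup_upper lp_bdd_above) blast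
  then show ?thesis unfolding avg by (simp only: pos_divide_le_eq[OF n])
qed

theorem theorem4:
  fixes V :: "'a set" and F :: "'a set set" and n k l q s :: nat
  assumes "finite V"
    and "even (card V)"
    and "\<And>e. e \<in> F \<Longrightarrow> e \<subseteq> V"
    and "card F = n"
    and "\<And>e. e \<in> F \<Longrightarrow> card e = k"
    and "\<And>v. v \<in> V \<Longrightarrow> card {e \<in> F. v \<in> e} = l"
    and "\<And>u v. u \<in> V \<Longrightarrow> v \<in> V \<Longrightarrow> u \<noteq> v \<Longrightarrow> card {e \<in> F. u \<in> e \<and> v \<in> e} \<le> q"
    and "s \<in> {1..k}"
  shows "real (SC2 V F s) \<le> lp_optimum k l q s * real n"
proof -
  have fin: "finite F" using assms(1,3) by (meson Pow_iff finite_Pow_iff finite_subset subsetI)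
  have "SC2 V F s \<in> {t. \<exists>P. pairing V P \<and> pairing_guarantees V F s P t}"
    unfolding SC2_def using SC2_Max_welldefined[OF fin] by (rule Max_in)
  then obtain P where P: "pairing V P" "pairing_guarantees V F s P (SC2 V F s)" by blast
  obtain f where f: "perfect_matching V f" "\<And>v w. {v, w} \<in> P \<Longrightarrow> f v = w"
    using pairing_extends_to_perfect_matching[OF P(1) assms(1,2)] by blast
  let ?c = "\<lambda>e. card {v \<in> e. f v \<notin> e}"
  have le: "real (SC2 V F s) \<le> (\<Sum>e\<in>F. lp_coeff k s (?c e))"
    using pairing_guarantee_le_average[OF assms(1,2) fin assms(3,5) P(1) f P(2)] .
  \<comment> \<open>Averaging over winning sets requires at least one of them.\<close>
  show ?thesis
  proof (cases "F = {}")
    case True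
    then show ?thesis using le assms(4) by simp
  next
    case False
    \<comment> \<open>Double counting of incidences between vertices and winning sets, for
      \<open>k * n = l * card V\<close>.\<close>
    have "(\<Sum>e\<in>F. card {v \<in> V. v \<in> e}) = (\<Sum>v\<in>V. card {e \<in> F. v \<in> e})"
      using fin assms(1) by (rule sum_multicount_gen) simp
    moreover have "{v \<in> V. v \<in> e} = e" if "e \<in> F" for e using assms(3)[OF that] by blast
    ultimately have kn: "k * n = l * card V" using assms(4-6) by (simp add: mult.commute)
    \<comment> \<open>\<open>1 \<le> s \<le> k\<close> makes \<open>k\<close> positive; then
      \<open>l > 0\<close>, and dividing by \<open>l\<close> is legitimate.\<close>
    moreover have "k * n > 0" using False fin assms(4,8) by (auto simp: card_gt_0_iff)
    ultimately have "l > 0" by (cases "l = 0") auto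
    \<comment> \<open>Scaled by \<open>n\<close>, the right-hand side of the constraint becomes
      \<open>k * n - q * card V\<close>, which is exactly the lower bound from counting pairs inside
      winning sets.\<close>
    have "real k * (real l - real q) / real l * n = (real l - real q) * (real (k * n) / real l)"
      by (simp add: field_simps)
    also have "\<dots> = (real l - real q) * card V"
      using \<open>l > 0\<close> by (simp add: kn)
    also have "\<dots> = real (k * n) - real (q * card V)"
      by (simp add: kn left_diff_distrib)
    also have "\<dots> \<le> (\<Sum>e\<in>F. real (?c e))"
    proof -
      have "k * n \<le> (\<Sum>e\<in>F. ?c e) + q * card V"
        using sum_singles_ge[OF assms(1) f(1) fin assms(3,5,7)] assms(4) by simp
      then have "real (k * n) \<le> real ((\<Sum>e\<in>F. ?c e) + q * card V)"
        by (rule of_nat_mono)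
      then show ?thesis by simp
    qed
    finally have "(\<Sum>e\<in>F. lp_coeff k s (?c e)) \<le> lp_optimum k l q s * card F"
      using card_transversals_hitting(1)[OF assms(1) f(1) assms(3)] assms(4,5)
      by (intro average_le_lp_optimum[OF fin False]) simp_all
    then show ?thesis using le assms(4) by simp
  qed
qed

end
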